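(* Let $\mathcal{A}$ be a category and $\mathcal{E}$ a class of morphisms in $\mathcal{A}$ such that $(\mathcal{A},\mathcal{E})$ satisfies (E1)--(E4). Then any augmented $\mathcal{E}$-semi-simplicial object in $\mathcal{A}$ which is contractible and satisfies the $\mathcal{E}$-Kan property is an $\mathcal{E}$-resolution.
   Context: Axioms: (E1) $\mathcal{E}$ contains all isomorphisms; (E2) pullbacks of morphisms in $\mathcal{E}$ (along arbitrary morphisms) exist in $\mathcal{A}$ and are in $\mathcal{E}$; (E3) $\mathcal{E}$ is closed under composition; (E4) if $g\circ f\in\mathcal{E}$ then $g\in\mathcal{E}$. An augmented semi-simplicial object $\mathbb{A}$ consists of objects $(A_n)_{n\geq -1}$ with faces $\partial_i\colon A_n\to A_{n-1}$, $0\leq i\leq n$, $n\geq 0$, such that $\partial_i\partial_j=\partial_{j-1}\partial_i$ for $i<j$. It is an augmented $\mathcal{E}$-semi-simplicial object when all faces $\partial_i$ (including the augmentation $\partial_0\colon A_0\to A_{-1}$) are in $\mathcal{E}$. $\mathbb{A}$ is contractible when there are morphisms $\sigma_{-1}\colon A_{n-1}\to A_n$ for all $n\geq 0$ such that $\partial_0\sigma_{-1}=1$ and $\partial_i\sigma_{-1}=\sigma_{-1}\partial_{i-1}$ for all $i\geq 1$ (whenever defined). $\mathcal{E}$-Kan property: for $n\geq 2$ and $0\leq k\leq n$, the object of $(n,k)$-horns $A(n,k)$ is an object with morphisms $a_i\colon A(n,k)\to A_{n-1}$, $i\in\{0,\dots,n\}\setminus\{k\}$, satisfying $\partial_ia_j=\partial_{j-1}a_i$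 for all $i<j$ with $i,j\neq k$, universal with this property. Also $A(1,0)=A(1,1)=A_0$. $\mathbb{A}$ satisfies the $\mathcal{E}$-Kan property (is $\mathcal{E}$-Kan) when all $A(n,k)$ ($n\geq 1$, $0\leq k\leq n$) exist and all comparison morphisms $A_n\to A(n,k)$ (induced by the $\partial_i$, $i\neq k$) are in $\mathcal{E}$; for $n=1$ these are $\partial_0\colon A_1\to A(1,0)$ and $\partial_1\colon A_1\to A(1,1)$. A simplicial kernel of morphisms $f_0,\dots,f_n\colon X\to Y$ is a sequence $(k_i\colon K\to X)_{0\leq i\leq n+1}$ with $f_ik_j=f_{j-1}k_i$ for $0\leq i<j\leq n+1$, universal with this property. Write $K_0\mathbb{A}=A_{-1}$ and, for $n\geq 1$, $K_n\mathbb{A}$ for the simplicial kernel (if it exists) of $\partial_0,\dots,\partial_{n-1}\colon A_{n-1}\to A_{n-2}$. $\mathbb{A}$ is an $\mathcal{E}$-resolution when for every $n\geq 0$ the object $K_n\mathbb{A}$ exists and the induced morphism $A_n\to K_n\mathbb{A}$ (which is $\partial_0$ for $n=0$, and is induced by $\partial_0,\dots,\partial_n$ for $n\geq 1$) is in $\mathcal{E}$. *)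

theory Defs
  imports Main
begin

section \<open>Categories\<close>

record ('o, 'm) category_data =
  Obj :: "'o set"
  Arr :: "'m set"
  Dom :: "'m \<Rightarrow> 'o"
  Cod :: "'m \<Rightarrow> 'o"
  Id :: "'o \<Rightarrow> 'm"
  Comp :: "'m \<Rightarrow> 'm \<Rightarrow> 'm"  (infixr "\<cdot>\<index>" 70)

definition Hom :: "('o, 'm, 'x) category_data_scheme \<Rightarrow> 'o \<Rightarrow> 'o \<Rightarrow> 'm set" where
  "Hom C X Y = {f \<in> Arr C. Dom C f = X \<and> Cod C f = Y}"

locale category =
  fixes C (structure)
  assumes Dom_closed: "f \<in> Arr C \<Longrightarrow> Dom C f \<in> Obj C"
    and Cod_closed: "f \<in> Arr C \<Longrightarrow> Cod C f \<in> Obj C"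
    and Id_closed: "X \<in> Obj C \<Longrightarrow> Id C X \<in> Hom C X X"
    and Comp_closed: "\<lbrakk>f \<in> Hom C X Y; g \<in> Hom C Y Z\<rbrakk> \<Longrightarrow> g \<cdot> f \<in> Hom C X Z"
    and Comp_assoc:
      "\<lbrakk>f \<in> Hom C W X; g \<in> Hom C X Y; h \<in> Hom C Y Z\<rbrakk> \<Longrightarrow> (h \<cdot> g) \<cdot> f = h \<cdot> (g \<cdot> f)"
    and Comp_Id_left: "f \<in> Hom C X Y \<Longrightarrow> Id C Y \<cdot> f = f"
    and Comp_Id_right: "f \<in> Hom C X Y \<Longrightarrow> f \<cdot> Id C X = f"

definition is_iso :: "('o, 'm, 'x) category_data_scheme \<Rightarrow> 'm \<Rightarrow> bool" where
  "is_iso C f \<longleftrightarrow> f \<in> Arr C \<and>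
     (\<exists>g \<in> Hom C (Cod C f) (Dom C f).
        g \<cdot>\<^bsub>C\<^esub> f = Id C (Dom C f) \<and> f \<cdot>\<^bsub>C\<^esub> g = Id C (Cod C f))"

text \<open>\<open>is_pullback C f g P p q\<close>: the square \<open>f \<cdot> p = g \<cdot> q\<close> with vertex \<open>P\<close> is a pullback of the
  cospan \<open>f\<close>, \<open>g\<close>. Thus \<open>q\<close> is the pullback of \<open>f\<close> along \<open>g\<close>.\<close>

definition is_pullback ::
  "('o, 'm, 'x) category_data_scheme \<Rightarrow> 'm \<Rightarrow> 'm \<Rightarrow> 'o \<Rightarrow> 'm \<Rightarrow> 'm \<Rightarrow> bool" where
  "is_pullback C f g P p q \<longleftrightarrow>
     P \<in> Obj C \<and> f \<in> Arr C \<and> g \<in> Arr C \<and> Cod C f = Cod C g \<and>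
     p \<in> Hom C P (Dom C f) \<and> q \<in> Hom C P (Dom C g) \<and> f \<cdot>\<^bsub>C\<^esub> p = g \<cdot>\<^bsub>C\<^esub> q \<and>
     (\<forall>Z \<in> Obj C. \<forall>u \<in> Hom C Z (Dom C f). \<forall>v \<in> Hom C Z (Dom C g).
        f \<cdot>\<^bsub>C\<^esub> u = g \<cdot>\<^bsub>C\<^esub> v \<longrightarrow>
        (\<exists>!h. h \<in> Hom C Z P \<and> p \<cdot>\<^bsub>C\<^esub> h = u \<and> q \<cdot>\<^bsub>C\<^esub> h = v))"

locale extension_category = category C for C (structure) +
  fixes E :: "'b set"
  assumes E_arr: "E \<subseteq> Arr C"
    and E1: "is_iso C f \<Longrightarrow> f \<in> E"
    and E2_ex: "\<lbrakk>f \<in> E; g \<in> Arr C; Cod C f = Cod C g\<rbrakk> \<Longrightarrow> \<exists>P p q. is_pullback C f g P p q"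
    and E2_closed: "\<lbrakk>f \<in> E; is_pullback C f g P p q\<rbrakk> \<Longrightarrow> q \<in> E"
    and E3: "\<lbrakk>f \<in> E; g \<in> E; Cod C f = Dom C g\<rbrakk> \<Longrightarrow> g \<cdot> f \<in> E"
    and E4: "\<lbrakk>f \<in> Arr C; g \<in> Arr C; Cod C f = Dom C g; g \<cdot> f \<in> E\<rbrakk> \<Longrightarrow> g \<in> E"


section \<open>Augmented semi-simplicial objects\<close>

text \<open>The object indices are shifted by one so that they are natural numbers: \<open>A n\<close> is the object
  usually written $A_{n-1}$, and in particular \<open>A 0\<close> is $A_{-1}$. The face indices are not shifted:
  \<open>d n i\<close> is $\partial_i : A_n \to A_{n-1}$, i.e. a morphism from \<open>A (Suc n)\<close> to \<open>A n\<close>. Values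
  \<open>d n i\<close> with \<open>i > n\<close> are irrelevant.\<close>

locale augmented_semisimplicial_object = category C for C (structure) +
  fixes A :: "nat \<Rightarrow> 'a" and d :: "nat \<Rightarrow> nat \<Rightarrow> 'b"
  assumes obj: "A n \<in> Obj C"
    and face: "i \<le> n \<Longrightarrow> d n i \<in> Hom C (A (Suc n)) (A n)"
    and face_face:
      "\<lbrakk>i < j; j \<le> Suc n\<rbrakk> \<Longrightarrow> d n i \<cdot> d (Suc n) j = d n (j - 1) \<cdot> d (Suc n) i"

locale augmented_E_semisimplicial_object =
  augmented_semisimplicial_object C A d for C (structure) and A d +
  fixes E :: "'b set"
  assumes face_in_E: "i \<le> n \<Longrightarrow> d n i \<in> E"

text \<open>With the shifted indices, \<open>s n\<close> is $\sigma_{-1} : A_{n-1} \to A_n$.\<close>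

definition contractible ::
  "('o, 'm, 'x) category_data_scheme \<Rightarrow> (nat \<Rightarrow> 'o) \<Rightarrow> (nat \<Rightarrow> nat \<Rightarrow> 'm) \<Rightarrow> bool" where
  "contractible C A d \<longleftrightarrow>
     (\<exists>s. (\<forall>n. s n \<in> Hom C (A n) (A (Suc n))) \<and>
          (\<forall>n. d n 0 \<cdot>\<^bsub>C\<^esub> s n = Id C (A n)) \<and>
          (\<forall>n i. 1 \<le> i \<and> i \<le> Suc n \<longrightarrow>
             d (Suc n) i \<cdot>\<^bsub>C\<^esub> s (Suc n) = s n \<cdot>\<^bsub>C\<^esub> d n (i - 1)))"


section \<open>Horns and the Kan property\<close>

text \<open>For \<open>n \<ge> 2\<close>: \<open>z i\<close> (for \<open>i \<le> n\<close>, \<open>i \<noteq> k\<close>) are morphisms from \<open>Z\<close> to $A_{n-1}$ that fit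
  together as the faces of an $(n,k)$-horn.\<close>

definition horn_cone ::
  "('o, 'm, 'x) category_data_scheme \<Rightarrow> (nat \<Rightarrow> 'o) \<Rightarrow> (nat \<Rightarrow> nat \<Rightarrow> 'm) \<Rightarrow> nat \<Rightarrow> nat \<Rightarrow>
     'o \<Rightarrow> (nat \<Rightarrow> 'm) \<Rightarrow> bool" where
  "horn_cone C A d n k Z z \<longleftrightarrow>
     Z \<in> Obj C \<and>
     (\<forall>i \<in> {0..n} - {k}. z i \<in> Hom C Z (A n)) \<and>
     (\<forall>i \<in> {0..n} - {k}. \<forall>j \<in> {0..n} - {k}. i < j \<longrightarrow>
        d (n - 1) i \<cdot>\<^bsub>C\<^esub> z j = d (n - 1) (j - 1) \<cdot>\<^bsub>C\<^esub> z i)"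

definition is_horn_object ::
  "('o, 'm, 'x) category_data_scheme \<Rightarrow> (nat \<Rightarrow> 'o) \<Rightarrow> (nat \<Rightarrow> nat \<Rightarrow> 'm) \<Rightarrow> nat \<Rightarrow> nat \<Rightarrow>
     'o \<Rightarrow> (nat \<Rightarrow> 'm) \<Rightarrow> bool" where
  "is_horn_object C A d n k H a \<longleftrightarrow>
     horn_cone C A d n k H a \<and>
     (\<forall>Z z. horn_cone C A d n k Z z \<longrightarrow>
        (\<exists>!h. h \<in> Hom C Z H \<and> (\<forall>i \<in> {0..n} - {k}. a i \<cdot>\<^bsub>C\<^esub> h = z i)))"

text \<open>For \<open>n = 1\<close> the horn objects are both $A_0$, with comparison morphisms \<open>d 1 0\<close> and \<open>d 1 1\<close>.
  For \<open>n \<ge> 2\<close> a horn object is determined up to isomorphism only; the condition is imposed on the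
  comparison morphism \<open>c\<close> into every choice of it, where \<open>c\<close> exists and is unique by the universal
  property.\<close>

definition E_Kan ::
  "('o, 'm, 'x) category_data_scheme \<Rightarrow> 'm set \<Rightarrow> (nat \<Rightarrow> 'o) \<Rightarrow> (nat \<Rightarrow> nat \<Rightarrow> 'm) \<Rightarrow> bool" where
  "E_Kan C E A d \<longleftrightarrow>
     d 1 0 \<in> E \<and> d 1 1 \<in> E \<and>
     (\<forall>n k. 2 \<le> n \<and> k \<le> n \<longrightarrow>
        (\<exists>H a. is_horn_object C A d n k H a) \<and>
        (\<forall>H a c. is_horn_object C A d n k H a \<and> c \<in> Hom C (A (Suc n)) H \<and>
           (\<forall>i \<in> {0..n} - {k}. a i \<cdot>\<^bsub>C\<^esub> c = d n i) \<longrightarrow> c \<in> E))"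


section \<open>Simplicial kernels and resolutions\<close>

definition simplicial_kernel_cone ::
  "('o, 'm, 'x) category_data_scheme \<Rightarrow> 'o \<Rightarrow> nat \<Rightarrow> (nat \<Rightarrow> 'm) \<Rightarrow> 'o \<Rightarrow> (nat \<Rightarrow> 'm) \<Rightarrow> bool" where
  "simplicial_kernel_cone C X n f Z z \<longleftrightarrow>
     Z \<in> Obj C \<and>
     (\<forall>i \<le> n + 1. z i \<in> Hom C Z X) \<and>
     (\<forall>i j. i < j \<and> j \<le> n + 1 \<longrightarrow> f i \<cdot>\<^bsub>C\<^esub> z j = f (j - 1) \<cdot>\<^bsub>C\<^esub> z i)"

text \<open>\<open>k 0, \<dots>, k (n + 1) : K \<rightarrow> X\<close> is a simplicial kernel of \<open>f 0, \<dots>, f n : X \<rightarrow> Y\<close>.\<close>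

definition is_simplicial_kernel ::
  "('o, 'm, 'x) category_data_scheme \<Rightarrow> 'o \<Rightarrow> 'o \<Rightarrow> nat \<Rightarrow> (nat \<Rightarrow> 'm) \<Rightarrow>
     'o \<Rightarrow> (nat \<Rightarrow> 'm) \<Rightarrow> bool" where
  "is_simplicial_kernel C X Y n f K k \<longleftrightarrow>
     (\<forall>i \<le> n. f i \<in> Hom C X Y) \<and>
     simplicial_kernel_cone C X n f K k \<and>
     (\<forall>Z z. simplicial_kernel_cone C X n f Z z \<longrightarrow>
        (\<exists>!h. h \<in> Hom C Z K \<and> (\<forall>i \<le> n + 1. k i \<cdot>\<^bsub>C\<^esub> h = z i)))"

text \<open>$K_n\mathbb{A}$ for \<open>n \<ge> 1\<close>: the simplicial kernel of
  $\partial_0, \ldots, \partial_{n-1} : A_{n-1} \to A_{n-2}$.\<close>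

definition is_K ::
  "('o, 'm, 'x) category_data_scheme \<Rightarrow> (nat \<Rightarrow> 'o) \<Rightarrow> (nat \<Rightarrow> nat \<Rightarrow> 'm) \<Rightarrow> nat \<Rightarrow>
     'o \<Rightarrow> (nat \<Rightarrow> 'm) \<Rightarrow> bool" where
  "is_K C A d n K k \<longleftrightarrow> is_simplicial_kernel C (A n) (A (n - 1)) (n - 1) (d (n - 1)) K k"

text \<open>The first conjunct is the case \<open>n = 0\<close>, where $K_0\mathbb{A} = A_{-1}$. For \<open>n \<ge> 1\<close>, as for
  horn objects, the condition is imposed on the induced morphism into every choice of the
  simplicial kernel.\<close>

definition E_resolution ::
  "('o, 'm, 'x) category_data_scheme \<Rightarrow> 'm set \<Rightarrow> (nat \<Rightarrow> 'o) \<Rightarrow> (nat \<Rightarrow> nat \<Rightarrow> 'm) \<Rightarrow> bool" where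
  "E_resolution C E A d \<longleftrightarrow>
     d 0 0 \<in> E \<and>
     (\<forall>n \<ge> 1.
        (\<exists>K k. is_K C A d n K k) \<and>
        (\<forall>K k c. is_K C A d n K k \<and> c \<in> Hom C (A (Suc n)) K \<and>
           (\<forall>i \<le> n. k i \<cdot>\<^bsub>C\<^esub> c = d n i) \<longrightarrow> c \<in> E))"

end

(* Given a point (x_0, ..., x_n) of the simplicial kernel K_n, contractibility makes
   (sigma x_0, ..., sigma x_n) an (n+1,0)-horn with faces indexed by 1, ..., n+1. The 0-th face of a
   filler of this horn is an element of A_n over (x_0, ..., x_n). Such fillers exist after pulling
   back along a morphism in E, so (E4) puts A_n -> K_n in E. The object K_n itself exists by
   induction: it is the pullback of A_{n-1} -> K_{n-1}, which is in E by the previous step, along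
   the morphism A(n,n) -> K_{n-1} that sends a horn to its family of last faces. *)

theory Submission
  imports Defs
begin

section \<open>Universal properties of simplicial kernels, horn objects and pullbacks\<close>

lemma is_simplicial_kernelD:
  assumes "is_simplicial_kernel C X Y n f K k"
  shows "K \<in> Obj C"
    and "i \<le> n + 1 \<Longrightarrow> k i \<in> Hom C K X"
    and "\<lbrakk>i < j; j \<le> n + 1\<rbrakk> \<Longrightarrow> f i \<cdot>\<^bsub>C\<^esub> k j = f (j - 1) \<cdot>\<^bsub>C\<^esub> k i"
    and "simplicial_kernel_cone C X n f Z z \<Longrightarrow>
      \<exists>!h. h \<in> Hom C Z K \<and> (\<forall>i \<le> n + 1. k i \<cdot>\<^bsub>C\<^esub> h = z i)"
  using assms unfolding is_simplicial_kernel_def simplicial_kernel_cone_def by auto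

lemma is_horn_objectD:
  assumes "is_horn_object C A d n k H a"
  shows "H \<in> Obj C"
    and "\<lbrakk>i \<le> n; i \<noteq> k\<rbrakk> \<Longrightarrow> a i \<in> Hom C H (A n)"
    and "\<lbrakk>i < j; j \<le> n; i \<noteq> k; j \<noteq> k\<rbrakk> \<Longrightarrow>
      d (n - 1) i \<cdot>\<^bsub>C\<^esub> a j = d (n - 1) (j - 1) \<cdot>\<^bsub>C\<^esub> a i"
    and "horn_cone C A d n k Z z \<Longrightarrow>
      \<exists>!h. h \<in> Hom C Z H \<and> (\<forall>i \<in> {0..n} - {k}. a i \<cdot>\<^bsub>C\<^esub> h = z i)"
  using assms unfolding is_horn_object_def horn_cone_def by auto

lemma is_pullbackD:
  assumes "is_pullback C f g P p q"
  shows "P \<in> Obj C" "p \<in> Hom C P (Dom C f)" "q \<in> Hom C P (Dom C g)"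
    and "f \<cdot>\<^bsub>C\<^esub> p = g \<cdot>\<^bsub>C\<^esub> q"
    and "\<lbrakk>Z \<in> Obj C; u \<in> Hom C Z (Dom C f); v \<in> Hom C Z (Dom C g);
      f \<cdot>\<^bsub>C\<^esub> u = g \<cdot>\<^bsub>C\<^esub> v\<rbrakk> \<Longrightarrow> \<exists>!h. h \<in> Hom C Z P \<and> p \<cdot>\<^bsub>C\<^esub> h = u \<and> q \<cdot>\<^bsub>C\<^esub> h = v"
  using assms unfolding is_pullback_def by auto

lemma HomD:
  assumes "f \<in> Hom C X Y"
  shows "f \<in> Arr C" "Dom C f = X" "Cod C f = Y"
  using assms unfolding Hom_def by auto

context extension_category
begin

lemma obtain_pullback:
  assumes "f \<in> E" "f \<in> Hom C X Z" "g \<in> Hom C Y Z"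
  obtains P p q where "is_pullback C f g P p q" "P \<in> Obj C"
    "p \<in> Hom C P X" "q \<in> Hom C P Y" "f \<cdot> p = g \<cdot> q"
proof -
  obtain P p q where P: "is_pullback C f g P p q"
    using E2_ex[of f g] assms HomD(1,3) by metis
  then show ?thesis
    using that is_pullbackD(1-4)[OF P] HomD[OF assms(2)] HomD[OF assms(3)] by auto
qed

end

section \<open>Cones, comparison morphisms and horns in a semi-simplicial object\<close>

context augmented_semisimplicial_object
begin

lemma comp_face_cong:
  assumes "i < j" "j \<le> Suc n" "z \<in> Hom C Z (A (Suc (Suc n)))"
  shows "d n i \<cdot> (d (Suc n) j \<cdot> z) = d n (j - 1) \<cdot> (d (Suc n) i \<cdot> z)"
proof -
  have "d n i \<cdot> (d (Suc n) j \<cdot> z) = (d n i \<cdot> d (Suc n) j) \<cdot> z"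
    using Comp_assoc[OF assms(3) face face, of j i] assms by simp
  also have "\<dots> = (d n (j - 1) \<cdot> d (Suc n) i) \<cdot> z"
    using face_face assms by simp
  also have "\<dots> = d n (j - 1) \<cdot> (d (Suc n) i \<cdot> z)"
    using Comp_assoc[OF assms(3) face face, of i "j - 1"] assms by simp
  finally show ?thesis .
qed

lemma simplicial_kernel_cone_comp:
  assumes K: "is_simplicial_kernel C (A (Suc m)) (A m) m (d m) K k" and u: "u \<in> Hom C Z K"
  shows "simplicial_kernel_cone C (A (Suc m)) m (d m) Z (\<lambda>i. k i \<cdot> u)"
  unfolding simplicial_kernel_cone_def
proof (intro conjI allI impI)
  show "Z \<in> Obj C"
    using Dom_closed HomD[OF u] by blast
  show "k i \<cdot> u \<in> Hom C Z (A (Suc m))" if "i \<le> m + 1" for i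
    using Comp_closed[OF u] is_simplicial_kernelD(2)[OF K that] .
  show "d m i \<cdot> (k j \<cdot> u) = d m (j - 1) \<cdot> (k i \<cdot> u)" if "i < j \<and> j \<le> m + 1" for i j
  proof -
    have k: "k i \<in> Hom C K (A (Suc m))" "k j \<in> Hom C K (A (Suc m))"
      using is_simplicial_kernelD(2)[OF K] that by auto
    have "d m i \<cdot> (k j \<cdot> u) = (d m i \<cdot> k j) \<cdot> u"
      using Comp_assoc[OF u k(2) face] that by simp
    also have "\<dots> = (d m (j - 1) \<cdot> k i) \<cdot> u"
      using is_simplicial_kernelD(3)[OF K] that by simp
    also have "\<dots> = d m (j - 1) \<cdot> (k i \<cdot> u)"
      using Comp_assoc[OF u k(1) face] that by (simp add: le_diff_conv)
    finally show ?thesis .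
  qed
qed

text \<open>Both morphisms factor the cone \<open>k i \<cdot> v\<close>, and such a factorization is
  unique. Thus the projections of a simplicial kernel are jointly monic.\<close>

lemma simplicial_kernel_eqI:
  assumes K: "is_simplicial_kernel C (A (Suc m)) (A m) m (d m) K k"
    and u: "u \<in> Hom C Z K" and v: "v \<in> Hom C Z K"
    and eq: "\<And>i. i \<le> Suc m \<Longrightarrow> k i \<cdot> u = k i \<cdot> v"
  shows "u = v"
proof -
  have "\<forall>i \<le> m + 1. k i \<cdot> u = k i \<cdot> v"
    using eq by simp
  then show ?thesis
    using is_simplicial_kernelD(4)[OF K simplicial_kernel_cone_comp[OF K v]] u v by blast
qed

text \<open>The simplicial identities make the faces of A_{m+1} a cone. With the shifted indices
  \<open>K\<close> is K_{m+1}, and \<open>c\<close> is the morphism that a resolution requires to be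
  in \<open>E\<close>.\<close>

lemma simplicial_kernel_comparison:
  assumes K: "is_simplicial_kernel C (A (Suc m)) (A m) m (d m) K k"
  obtains c where "c \<in> Hom C (A (Suc (Suc m))) K" "\<And>i. i \<le> Suc m \<Longrightarrow> k i \<cdot> c = d (Suc m) i"
proof -
  have "simplicial_kernel_cone C (A (Suc m)) m (d m) (A (Suc (Suc m))) (d (Suc m))"
    unfolding simplicial_kernel_cone_def using obj face face_face by auto
  from is_simplicial_kernelD(4)[OF K this] show thesis
    using that by auto
qed

text \<open>Again by the simplicial identities. Writing the dimension as m+2 builds in the bound n
  \<ge> 2 under which horns are given by a universal property.\<close>

lemma horn_comparison:
  assumes H: "is_horn_object C A d (Suc (Suc m)) k H a"
  obtains e where "e \<in> Hom C (A (Suc (Suc (Suc m)))) H"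
    "\<And>i. i \<le> Suc (Suc m) \<Longrightarrow> i \<noteq> k \<Longrightarrow> a i \<cdot> e = d (Suc (Suc m)) i"
proof -
  have "horn_cone C A d (Suc (Suc m)) k (A (Suc (Suc (Suc m)))) (d (Suc (Suc m)))"
    unfolding horn_cone_def using obj face face_face by auto
  from is_horn_objectD(4)[OF H this] obtain e where "e \<in> Hom C (A (Suc (Suc (Suc m)))) H"
    "\<forall>i \<in> {0..Suc (Suc m)} - {k}. a i \<cdot> e = d (Suc (Suc m)) i"
    by blast
  moreover have "i \<in> {0..Suc (Suc m)} - {k}" if "i \<le> Suc (Suc m)" "i \<noteq> k" for i
    using that by simp
  ultimately show thesis
    using that by blast
qed

text \<open>The contraction turns the cone \<open>k\<close> into a horn one dimension higher,
  shifting indices by one and leaving face 0 open. The horn relations become sigma applied to the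
  kernel relations.\<close>

lemma simplicial_kernel_degeneracy_horn:
  assumes s: "\<And>n. s n \<in> Hom C (A n) (A (Suc n))"
    and ds: "\<And>n i. \<lbrakk>1 \<le> i; i \<le> Suc n\<rbrakk> \<Longrightarrow> d (Suc n) i \<cdot> s (Suc n) = s n \<cdot> d n (i - 1)"
    and K: "is_simplicial_kernel C (A (Suc m)) (A m) m (d m) K k"
  shows "horn_cone C A d (Suc (Suc m)) 0 K (\<lambda>i. s (Suc m) \<cdot> k (i - 1))"
  unfolding horn_cone_def
proof (intro conjI ballI impI)
  note k = is_simplicial_kernelD(2)[OF K]
  show "K \<in> Obj C"
    using is_simplicial_kernelD(1)[OF K] .
  show "s (Suc m) \<cdot> k (i - 1) \<in> Hom C K (A (Suc (Suc m)))" if "i \<in> {0..Suc (Suc m)} - {0}" for i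
    using Comp_closed[OF k s, of "i - 1"] that by (simp add: le_diff_conv)
  have dsk: "d (Suc m) i \<cdot> (s (Suc m) \<cdot> k j) = s m \<cdot> (d m (i - 1) \<cdot> k j)"
    if "1 \<le> i" "i \<le> Suc m" "j \<le> Suc m" for i j
  proof -
    have "d (Suc m) i \<cdot> (s (Suc m) \<cdot> k j) = (d (Suc m) i \<cdot> s (Suc m)) \<cdot> k j"
      using Comp_assoc[OF k s face] that by simp
    also have "\<dots> = (s m \<cdot> d m (i - 1)) \<cdot> k j"
      using ds that by simp
    also have "\<dots> = s m \<cdot> (d m (i - 1) \<cdot> k j)"
      using Comp_assoc[OF k face s] that by simp
    finally show ?thesis .
  qed
  \<comment> \<open>Since 1 \<le> i < j, both face indices \<open>i\<close> and \<open>j - 1\<close>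
    are at least 1, so each face can be moved past sigma. What remains is the kernel relation for
    the pair (i-1, j-1).\<close>
  show "d (Suc (Suc m) - 1) i \<cdot> (s (Suc m) \<cdot> k (j - 1)) =
      d (Suc (Suc m) - 1) (j - 1) \<cdot> (s (Suc m) \<cdot> k (i - 1))"
    if "i \<in> {0..Suc (Suc m)} - {0}" "j \<in> {0..Suc (Suc m)} - {0}" "i < j" for i j
    using dsk[of i "j - 1"] dsk[of "j - 1" "i - 1"] that
      is_simplicial_kernelD(3)[OF K, of "i - 1" "j - 1"] by simp
qed

text \<open>A missing face x of the horn would satisfy d_i x = d_{m+1} a_i, so this family is the
  boundary prescribed for x. It is a cone because d_i d_{m+1} a_j = d_m d_i a_j = d_m d_{j-1} a_i =
  d_{j-1} d_{m+1} a_i.\<close>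

lemma horn_last_faces_cone:
  assumes H: "is_horn_object C A d (Suc (Suc m)) (Suc (Suc m)) H a"
  shows "simplicial_kernel_cone C (A (Suc m)) m (d m) H (\<lambda>i. d (Suc m) (Suc m) \<cdot> a i)"
  unfolding simplicial_kernel_cone_def
proof (intro conjI allI impI)
  show "H \<in> Obj C"
    using is_horn_objectD(1)[OF H] .
  have a: "a i \<in> Hom C H (A (Suc (Suc m)))" if "i \<le> Suc m" for i
    using is_horn_objectD(2)[OF H] that by simp
  show "d (Suc m) (Suc m) \<cdot> a i \<in> Hom C H (A (Suc m))" if "i \<le> m + 1" for i
    using Comp_closed[OF a face] that by simp
  show "d m i \<cdot> (d (Suc m) (Suc m) \<cdot> a j) = d m (j - 1) \<cdot> (d (Suc m) (Suc m) \<cdot> a i)"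
    if "i < j \<and> j \<le> m + 1" for i j
  proof -
    have "d m i \<cdot> (d (Suc m) (Suc m) \<cdot> a j) = d m m \<cdot> (d (Suc m) i \<cdot> a j)"
      using comp_face_cong[OF _ _ a, of i "Suc m" j] that by simp
    also have "\<dots> = d m m \<cdot> (d (Suc m) (j - 1) \<cdot> a i)"
      using is_horn_objectD(3)[OF H, of i j] that by simp
    also have "\<dots> = d m (j - 1) \<cdot> (d (Suc m) (Suc m) \<cdot> a i)"
      using comp_face_cong[OF _ _ a, of "j - 1" "Suc m" i] that less_Suc_eq_le by fastforce
    finally show ?thesis .
  qed
qed

section \<open>Simplicial kernels constructed as pullbacks\<close>

lemma simplicial_kernel_from_kernel_pair:
  assumes P: "is_pullback C (d 0 0) (d 0 0) K p q"
  shows "is_simplicial_kernel C (A (Suc 0)) (A 0) 0 (d 0) K (\<lambda>i. if i = 0 then p else q)"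
proof -
  have D: "Dom C (d 0 0) = A (Suc 0)"
    using HomD(2)[OF face[of 0 0]] by simp
  have "simplicial_kernel_cone C (A (Suc 0)) 0 (d 0) K (\<lambda>i. if i = 0 then p else q)"
    unfolding simplicial_kernel_cone_def
  proof (intro conjI allI impI)
    show "d 0 i \<cdot> (if j = 0 then p else q) = d 0 (j - 1) \<cdot> (if i = 0 then p else q)"
      if "i < j \<and> j \<le> 0 + 1" for i j
    proof -
      \<comment> \<open>A single morphism leaves only the relation f_0 k_1 = f_0 k_0, which is the
        kernel pair square.\<close>
      from that have "i = 0" "j = 1"
        by linarith+
      then show ?thesis
        using is_pullbackD(4)[OF P] by simp
    qed
  qed (use is_pullbackD(1-3)[OF P] D in auto)
  moreover have "\<exists>!h. h \<in> Hom C Z K \<and> (\<forall>i \<le> 0 + 1. (if i = 0 then p else q) \<cdot> h = z i)"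
    if z: "simplicial_kernel_cone C (A (Suc 0)) 0 (d 0) Z z" for Z z
  proof -
    have z': "Z \<in> Obj C" "z 0 \<in> Hom C Z (A (Suc 0))" "z 1 \<in> Hom C Z (A (Suc 0))"
        "d 0 0 \<cdot> z 0 = d 0 0 \<cdot> z 1"
      using z unfolding simplicial_kernel_cone_def by force+
    have "(\<forall>i \<le> 0 + 1. (if i = 0 then p else q) \<cdot> h = z i) \<longleftrightarrow> p \<cdot> h = z 0 \<and> q \<cdot> h = z 1" for h
      using le_Suc_eq[of _ 0] by auto
    then show ?thesis
      using is_pullbackD(5)[OF P, of Z "z 0" "z 1"] z' D by simp
  qed
  ultimately show ?thesis
    unfolding is_simplicial_kernel_def using face by auto
qed

text \<open>A cone (z_0, ..., z_{m+2}) splits into the horn (z_0, ..., z_{m+1}) and its last member.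
  The relations with j \<le> m+1 are the horn relations; those with j = m+2 say d_i z_{m+2} =
  d_{m+1} z_i, which is agreement of \<open>c\<close> on z_{m+2} with \<open>l\<close> on the
  horn.\<close>

lemma simplicial_kernel_from_pullback:
  assumes K: "is_simplicial_kernel C (A (Suc m)) (A m) m (d m) K k"
    and c: "c \<in> Hom C (A (Suc (Suc m))) K" "\<And>i. i \<le> Suc m \<Longrightarrow> k i \<cdot> c = d (Suc m) i"
    and H: "is_horn_object C A d (Suc (Suc m)) (Suc (Suc m)) H a"
    and l: "l \<in> Hom C H K" "\<And>i. i \<le> Suc m \<Longrightarrow> k i \<cdot> l = d (Suc m) (Suc m) \<cdot> a i"
    and P: "is_pullback C c l P p q"
  shows "is_simplicial_kernel C (A (Suc (Suc m))) (A (Suc m)) (Suc m) (d (Suc m)) P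
    (\<lambda>i. if i = Suc (Suc m) then p else a i \<cdot> q)"
    (is "is_simplicial_kernel _ _ _ _ _ _ ?k")
proof -
  let ?X = "A (Suc (Suc m))"
  have a: "a i \<in> Hom C H ?X" if "i \<le> Suc m" for i
    using is_horn_objectD(2)[OF H] that by simp
  have k: "k i \<in> Hom C K (A (Suc m))" if "i \<le> Suc m" for i
    using is_simplicial_kernelD(2)[OF K] that by simp
  have p: "p \<in> Hom C P ?X" and q: "q \<in> Hom C P H"
    using is_pullbackD(2,3)[OF P] HomD[OF c(1)] HomD[OF l(1)] by auto
  \<comment> \<open>Through the projections \<open>k i\<close>, an equation between
    \<open>c \<cdot> u\<close> and \<open>l \<cdot> v\<close> becomes the family d_i u = d_{m+1} a_i
    v.\<close>
  have kcu: "k i \<cdot> (c \<cdot> u) = d (Suc m) i \<cdot> u" if "u \<in> Hom C Z ?X" "i \<le> Suc m" for u i Z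
    using Comp_assoc[OF that(1) c(1) k] c(2) that by simp
  have klv: "k i \<cdot> (l \<cdot> v) = d (Suc m) (Suc m) \<cdot> (a i \<cdot> v)"
    if "v \<in> Hom C Z H" "i \<le> Suc m" for v i Z
    using Comp_assoc[OF that(1) l(1) k] Comp_assoc[OF that(1) a face] l(2) that by simp
  have "simplicial_kernel_cone C ?X (Suc m) (d (Suc m)) P ?k"
    unfolding simplicial_kernel_cone_def
  proof (intro conjI allI impI)
    show "P \<in> Obj C"
      using is_pullbackD(1)[OF P] .
    show "?k i \<in> Hom C P ?X" if "i \<le> Suc m + 1" for i
      using p Comp_closed[OF q a] that by simp
    show "d (Suc m) i \<cdot> ?k j = d (Suc m) (j - 1) \<cdot> ?k i" if ij: "i < j \<and> j \<le> Suc m + 1" for i j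
    proof (cases "j = Suc (Suc m)")
      case True
      then show ?thesis
        using kcu[OF p, of i] klv[OF q, of i] is_pullbackD(4)[OF P] ij by simp
    next
      case False
      have "d (Suc m) i \<cdot> (a j \<cdot> q) = (d (Suc m) i \<cdot> a j) \<cdot> q"
        using Comp_assoc[OF q a face] ij False by simp
      also have "\<dots> = (d (Suc m) (j - 1) \<cdot> a i) \<cdot> q"
        using is_horn_objectD(3)[OF H, of i j] ij False by simp
      also have "\<dots> = d (Suc m) (j - 1) \<cdot> (a i \<cdot> q)"
        using Comp_assoc[OF q a face, of i "j - 1"] ij False by (simp add: le_diff_conv)
      finally show ?thesis
        using ij False by simp
    qed
  qed
  moreover have "\<exists>!h. h \<in> Hom C Z P \<and> (\<forall>i \<le> Suc m + 1. ?k i \<cdot> h = z i)"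
    if z: "simplicial_kernel_cone C ?X (Suc m) (d (Suc m)) Z z" for Z z
  proof -
    have Z: "Z \<in> Obj C"
      using z unfolding simplicial_kernel_cone_def by blast
    have zX: "z i \<in> Hom C Z ?X" if "i \<le> Suc (Suc m)" for i
      using z that unfolding simplicial_kernel_cone_def by auto
    have zz: "d (Suc m) i \<cdot> z j = d (Suc m) (j - 1) \<cdot> z i" if "i < j" "j \<le> Suc (Suc m)" for i j
      using z that unfolding simplicial_kernel_cone_def by auto
    have "horn_cone C A d (Suc (Suc m)) (Suc (Suc m)) Z z"
      unfolding horn_cone_def using Z zX zz by auto
    moreover have "{0..Suc (Suc m)} - {Suc (Suc m)} = {..Suc m}"
      by auto
    ultimately have ex1v: "\<exists>!v. v \<in> Hom C Z H \<and> (\<forall>i \<le> Suc m. a i \<cdot> v = z i)"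
      using is_horn_objectD(4)[OF H] by (simp add: Ball_def)
    then obtain v where v: "v \<in> Hom C Z H" "\<And>i. i \<le> Suc m \<Longrightarrow> a i \<cdot> v = z i"
      by auto
    have last: "z (Suc (Suc m)) \<in> Hom C Z ?X"
      using zX by simp
    \<comment> \<open>By joint monicity of the \<open>k i\<close>, this is exactly the set of cone
      relations with j = m+2.\<close>
    have "c \<cdot> z (Suc (Suc m)) = l \<cdot> v"
    proof (rule simplicial_kernel_eqI[OF K])
      show "c \<cdot> z (Suc (Suc m)) \<in> Hom C Z K" "l \<cdot> v \<in> Hom C Z K"
        using Comp_closed[OF last c(1)] Comp_closed[OF v(1) l(1)] by auto
      show "k i \<cdot> (c \<cdot> z (Suc (Suc m))) = k i \<cdot> (l \<cdot> v)" if "i \<le> Suc m" for i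
        using kcu[OF last that] klv[OF v(1) that] v(2) zz[of i "Suc (Suc m)"] that by simp
    qed
    then have "\<exists>!h. h \<in> Hom C Z P \<and> p \<cdot> h = z (Suc (Suc m)) \<and> q \<cdot> h = v"
      using is_pullbackD(5)[OF P] Z last v(1) HomD[OF c(1)] HomD[OF l(1)] by simp
    moreover have "(\<forall>i \<le> Suc m + 1. ?k i \<cdot> h = z i) = (p \<cdot> h = z (Suc (Suc m)) \<and> q \<cdot> h = v)"
      if h: "h \<in> Hom C Z P" for h
    proof -
      \<comment> \<open>From right to left this is the uniqueness in \<open>ex1v\<close>: a morphism
        into the horn object is determined by its components. It matches the two components of the
        pullback with the m+3 components of the kernel.\<close>
      have "q \<cdot> h = v \<longleftrightarrow> (\<forall>i \<le> Suc m. a i \<cdot> (q \<cdot> h) = z i)"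
        using ex1v v Comp_closed[OF h q] by blast
      also have "\<dots> \<longleftrightarrow> (\<forall>i \<le> Suc m. (a i \<cdot> q) \<cdot> h = z i)"
        using Comp_assoc[OF h q a] by simp
      finally have qh: "q \<cdot> h = v \<longleftrightarrow> (\<forall>i \<le> Suc m. (a i \<cdot> q) \<cdot> h = z i)" .
      have "(\<forall>i \<le> Suc (Suc m). Q i) \<longleftrightarrow> Q (Suc (Suc m)) \<and> (\<forall>i \<le> Suc m. Q i)" for Q
        by (metis le_Suc_eq)
      then show ?thesis
        unfolding qh by simp
    qed
    ultimately show ?thesis
      by (simp only: cong: conj_cong)
  qed
  ultimately show ?thesis
    unfolding is_simplicial_kernel_def using face by auto
qed

end

section \<open>Comparison morphisms and existence of simplicial kernels for contractible Kan
  objects\<close>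

locale Kan_contractible_object =
  extension_category C E + augmented_E_semisimplicial_object C A d E
  for C (structure) and E A d +
  assumes contractible: "contractible C A d"
    and Kan: "E_Kan C E A d"
begin

lemma obtain_horn_object:
  assumes "k \<le> Suc (Suc m)"
  obtains H a where "is_horn_object C A d (Suc (Suc m)) k H a"
proof -
  have "2 \<le> Suc (Suc m)"
    by simp
  then show thesis
    using Kan assms that unfolding E_Kan_def by blast
qed

lemma horn_comparison_in_E:
  assumes "is_horn_object C A d (Suc (Suc m)) k H a" "k \<le> Suc (Suc m)"
    and "e \<in> Hom C (A (Suc (Suc (Suc m)))) H"
    and "\<And>i. i \<le> Suc (Suc m) \<Longrightarrow> i \<noteq> k \<Longrightarrow> a i \<cdot> e = d (Suc (Suc m)) i"
  shows "e \<in> E"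
proof -
  have "2 \<le> Suc (Suc m)"
    by simp
  moreover have "\<forall>i \<in> {0..Suc (Suc m)} - {k}. a i \<cdot> e = d (Suc (Suc m)) i"
    using assms(4) by auto
  ultimately show ?thesis
    using Kan assms unfolding E_Kan_def by blast
qed

text \<open>By (E4) it suffices to find \<open>?f\<close> with \<open>c \<cdot> ?f\<close> in
  \<open>E\<close>. The argument takes a simplicial kernel as given, so it can be used inside the
  induction that constructs these kernels.\<close>

lemma simplicial_kernel_comparison_in_E:
  assumes K: "is_simplicial_kernel C (A (Suc m)) (A m) m (d m) K k"
    and c: "c \<in> Hom C (A (Suc (Suc m))) K" "\<And>i. i \<le> Suc m \<Longrightarrow> k i \<cdot> c = d (Suc m) i"
  shows "c \<in> E"
proof -
  obtain s where s: "\<And>n. s n \<in> Hom C (A n) (A (Suc n))"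
    and s0: "\<And>n. d n 0 \<cdot> s n = Id C (A n)"
    and ds: "\<And>n i. \<lbrakk>1 \<le> i; i \<le> Suc n\<rbrakk> \<Longrightarrow> d (Suc n) i \<cdot> s (Suc n) = s n \<cdot> d n (i - 1)"
    using contractible unfolding contractible_def by blast
  obtain H a where H: "is_horn_object C A d (Suc (Suc m)) 0 H a"
    using obtain_horn_object by blast
  obtain e where e: "e \<in> Hom C (A (Suc (Suc (Suc m)))) H"
    and ae: "\<And>i. i \<le> Suc (Suc m) \<Longrightarrow> i \<noteq> 0 \<Longrightarrow> a i \<cdot> e = d (Suc (Suc m)) i"
    using horn_comparison[OF H] by blast
  have "e \<in> E"
    using horn_comparison_in_E[OF H _ e ae] by simp
  obtain h where h: "h \<in> Hom C K H"
    and "\<forall>i \<in> {0..Suc (Suc m)} - {0}. a i \<cdot> h = s (Suc m) \<cdot> k (i - 1)"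
    using is_horn_objectD(4)[OF H simplicial_kernel_degeneracy_horn[OF s ds K]] by blast
  then have ah: "a (Suc i) \<cdot> h = s (Suc m) \<cdot> k i" if "i \<le> Suc m" for i
    using that by simp
  \<comment> \<open>\<open>P\<close> consists of pairs of a simplex of dimension m+2 and a point of
    \<open>K\<close> whose associated horn it fills. Since \<open>e\<close> is in \<open>E\<close>,
    so is the projection \<open>q\<close> to \<open>K\<close>.\<close>
  obtain P p q where P: "is_pullback C e h P p q"
    and p: "p \<in> Hom C P (A (Suc (Suc (Suc m))))" and q: "q \<in> Hom C P K" and eq: "e \<cdot> p = h \<cdot> q"
    using obtain_pullback[OF \<open>e \<in> E\<close> e h] by blast
  have d0: "d (Suc (Suc m)) 0 \<in> Hom C (A (Suc (Suc (Suc m)))) (A (Suc (Suc m)))"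
    and d0': "d (Suc m) 0 \<in> Hom C (A (Suc (Suc m))) (A (Suc m))"
    using face by auto
  \<comment> \<open>This is the face of the filler that the horn leaves open.\<close>
  let ?f = "d (Suc (Suc m)) 0 \<cdot> p"
  have f: "?f \<in> Hom C P (A (Suc (Suc m)))"
    using Comp_closed[OF p d0] .
  have "c \<cdot> ?f = q"
  proof (rule simplicial_kernel_eqI[OF K])
    show "c \<cdot> ?f \<in> Hom C P K" "q \<in> Hom C P K"
      using Comp_closed[OF f c(1)] q by auto
    fix i assume i: "i \<le> Suc m"
    have k: "k i \<in> Hom C K (A (Suc m))"
      using is_simplicial_kernelD(2)[OF K] i by simp
    have kq: "k i \<cdot> q \<in> Hom C P (A (Suc m))"
      using Comp_closed[OF q k] .
    have a: "a (Suc i) \<in> Hom C H (A (Suc (Suc m)))"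
      using is_horn_objectD(2)[OF H] i by simp
    have "k i \<cdot> (c \<cdot> ?f) = d (Suc m) i \<cdot> ?f"
      using Comp_assoc[OF f c(1) k] c(2) i by simp
    \<comment> \<open>The identity d_i d_0 = d_0 d_{i+1} brings in face i+1 of the filler, which the
      horn prescribes as sigma k_i q.\<close>
    also have "\<dots> = d (Suc m) 0 \<cdot> (d (Suc (Suc m)) (Suc i) \<cdot> p)"
      using comp_face_cong[OF _ _ p, of 0 "Suc i"] i by simp
    also have "\<dots> = d (Suc m) 0 \<cdot> (a (Suc i) \<cdot> (e \<cdot> p))"
      using Comp_assoc[OF p e a] ae i by simp
    also have "\<dots> = d (Suc m) 0 \<cdot> (s (Suc m) \<cdot> (k i \<cdot> q))"
      using Comp_assoc[OF q h a] Comp_assoc[OF q k s] ah i eq by simp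
    \<comment> \<open>Here d_0 sigma = 1 removes the contraction.\<close>
    also have "\<dots> = k i \<cdot> q"
      using Comp_assoc[OF kq s d0'] s0 Comp_Id_left[OF kq] by simp
    finally show "k i \<cdot> (c \<cdot> ?f) = k i \<cdot> q" .
  qed
  moreover have "q \<in> E"
    using E2_closed[OF \<open>e \<in> E\<close> P] .
  ultimately show ?thesis
    using E4[of ?f c] HomD[OF f] HomD[OF c(1)] by simp
qed

text \<open>Level \<open>m\<close> concerns K_{m+1}, so the induction starts at K_1, the kernel pair
  of the augmentation, which is in \<open>E\<close>. In the step, the comparison into the kernel
  already built is in \<open>E\<close>, so (E2) supplies the pullback that is the next
  kernel.\<close>

lemma simplicial_kernel_exists:
  "\<exists>K k. is_simplicial_kernel C (A (Suc m)) (A m) m (d m) K k"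
proof (induction m)
  case 0
  have "d 0 0 \<in> E" "d 0 0 \<in> Hom C (A (Suc 0)) (A 0)"
    using face_in_E face by auto
  then show ?case
    using obtain_pullback simplicial_kernel_from_kernel_pair by metis
next
  case (Suc m)
  then obtain K k where K: "is_simplicial_kernel C (A (Suc m)) (A m) m (d m) K k"
    by blast
  obtain c where c: "c \<in> Hom C (A (Suc (Suc m))) K" "\<And>i. i \<le> Suc m \<Longrightarrow> k i \<cdot> c = d (Suc m) i"
    using simplicial_kernel_comparison[OF K] by blast
  obtain H a where H: "is_horn_object C A d (Suc (Suc m)) (Suc (Suc m)) H a"
    using obtain_horn_object by blast
  \<comment> \<open>\<open>l\<close> sends a horn to the boundary prescribed for its missing last
    face.\<close>
  obtain l where l: "l \<in> Hom C H K" "\<And>i. i \<le> Suc m \<Longrightarrow> k i \<cdot> l = d (Suc m) (Suc m) \<cdot> a i"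
    using is_simplicial_kernelD(4)[OF K horn_last_faces_cone[OF H]] by auto
  obtain P p q where "is_pullback C c l P p q"
    using obtain_pullback[OF simplicial_kernel_comparison_in_E[OF K c] c(1) l(1)] by blast
  then show ?case
    using simplicial_kernel_from_pullback[OF K c H l] by blast
qed

end

section \<open>The resolution property in all dimensions\<close>

theorem proposition3p9:
  fixes C :: "('o, 'm, 'x) category_data_scheme"
    and E :: "'m set"
    and A :: "nat \<Rightarrow> 'o"
    and d :: "nat \<Rightarrow> nat \<Rightarrow> 'm"
  assumes "extension_category C E"
    and "augmented_E_semisimplicial_object C A d E"
    and "contractible C A d"
    and "E_Kan C E A d"
  shows "E_resolution C E A d"
proof -
  interpret Kan_contractible_object C E A d
    using assms by (simp add: Kan_contractible_object_def Kan_contractible_object_axioms_def)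
  show ?thesis
    unfolding E_resolution_def
  proof (intro conjI allI impI)
    show "d 0 0 \<in> E"
      using face_in_E by simp
    fix n :: nat assume "1 \<le> n"
    \<comment> \<open>K_n is formed from the faces leaving A_{n-1}; writing n as
      \<open>Suc m\<close> turns \<open>d (n - 1)\<close> into \<open>d m\<close>, the form used in
      the lemmas.\<close>
    then obtain m where n: "n = Suc m"
      by (cases n) auto
    show "\<exists>K k. is_K C A d n K k"
      using simplicial_kernel_exists unfolding is_K_def n by simp
    show "c \<in> E" if "is_K C A d n K k \<and> c \<in> Hom C (A (Suc n)) K \<and>
        (\<forall>i \<le> n. k i \<cdot>\<^bsub>C\<^esub> c = d n i)" for K k c
      using simplicial_kernel_comparison_in_E[of m K k c] that unfolding is_K_def n by simp
  qed
qed

end
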